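(* Let $G_1$ and $G_2$ be graphs and let $H = G_1 \circ G_2$. A special subgraph $H_s$ of $H$ is a comparability graph if and only if its underlying lexicographic map is a comparability graph.
   Context: All graphs are simple, undirected and finite. A comparability graph is a graph admitting a transitive orientation. A graph is word-representable if there is a word $w$ over its vertex set such that two distinct vertices are adjacent iff their occurrences alternate in $w$. The lexicographic product $H = G_1 \circ G_2$ has vertex set $V(G_1)\times V(G_2)$, with $(u,v)$ and $(x,y)$ adjacent iff $\{u,x\}\in E(G_1)$, or $u=x$ and $\{v,y\}\in E(G_2)$. For $v_i \in V(G_1)$ the supervertex $V_i = \{(v_i,u) : u \in V(G_2)\}$. For a subgraph $G_1'$ of $G_1$, the lexicographic map $\mathcal{L}_H(G_1')$ is the subgraph of $H$ on vertex set $V(H)$ with no edges inside any supervertex and, for each edge $v_iv_j \in E(G_1')$, all edges between $V_i$ and $V_j$. A special subgraph of $H$ is any subgraph of $H$ obtained, for some word-representable subgraph $G_1'$ of $G_1$, from $\mathcal{L}_H(G_1')$ by adding edges of $H$ inside each supervertex $V_i$ such that the graph formed on $V_i$ by these added edges is a comparability graph (possibly with isolated vertices). The underlying lexicographic map of a special subgraph is the spanning subgraph obtained by deleting all edges inside supervertices. *)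

theory Defs
  imports "Graph_Theory.Graph_Theory"
begin

text \<open>
  Simple finite undirected graphs are the \<^const>\<open>pair_graph\<close>s of the AFP Graph-Theory library:
  an edge \<open>{u, v}\<close> is the pair of arcs \<open>(u, v)\<close>, \<open>(v, u)\<close>.
\<close>

text \<open>
  An orientation contains exactly one of the two arcs of each edge.
\<close>

definition orientation :: "'a pair_pre_digraph \<Rightarrow> 'a rel \<Rightarrow> bool" where
  "orientation G R \<longleftrightarrow> R \<union> R\<inverse> = parcs G \<and> R \<inter> R\<inverse> = {}"

definition comparability_graph :: "'a pair_pre_digraph \<Rightarrow> bool" where
  "comparability_graph G \<longleftrightarrow> pair_graph G \<and> (\<exists>R. orientation G R \<and> trans R)"

text \<open>
  Distinct letters \<open>x\<close> and \<open>y\<close> alternate in \<open>w\<close> if deleting all other letters from \<open>w\<close> leaves a word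
  of the form \<open>xyxy\<dots>\<close> or \<open>yxyx\<dots>\<close>.
\<close>

definition alternate :: "'a list \<Rightarrow> 'a \<Rightarrow> 'a \<Rightarrow> bool" where
  "alternate w x y \<longleftrightarrow> distinct_adj (filter (\<lambda>z. z = x \<or> z = y) w)"

text \<open>
  By the usual convention, a word representing \<open>G\<close> contains every vertex of \<open>G\<close> at least once.
\<close>

definition word_representable :: "'a pair_pre_digraph \<Rightarrow> bool" where
  "word_representable G \<longleftrightarrow> pair_graph G \<and>
     (\<exists>w. set w = pverts G \<and>
       (\<forall>x \<in> pverts G. \<forall>y \<in> pverts G. x \<noteq> y \<longrightarrow> ((x, y) \<in> parcs G \<longleftrightarrow> alternate w x y)))"

definition lex_product ::
    "'a pair_pre_digraph \<Rightarrow> 'b pair_pre_digraph \<Rightarrow> ('a \<times> 'b) pair_pre_digraph" where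
  "lex_product G1 G2 =
     \<lparr> pverts = pverts G1 \<times> pverts G2,
       parcs = {((u, v), (x, y)) | u v x y.
         (u, v) \<in> pverts G1 \<times> pverts G2 \<and> (x, y) \<in> pverts G1 \<times> pverts G2 \<and>
         ((u, x) \<in> parcs G1 \<or> u = x \<and> (v, y) \<in> parcs G2)} \<rparr>"

definition supervertex :: "'b pair_pre_digraph \<Rightarrow> 'a \<Rightarrow> ('a \<times> 'b) set" where
  "supervertex G2 v = {(v, u) | u. u \<in> pverts G2}"

text \<open>
  In \<open>lex_map G1 G2 G1'\<close>, the vertex set is that of the whole product, even if \<open>G1'\<close> does not
  span \<open>G1\<close>.
\<close>

definition lex_map ::
    "'a pair_pre_digraph \<Rightarrow> 'b pair_pre_digraph \<Rightarrow> 'a pair_pre_digraph \<Rightarrow>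
      ('a \<times> 'b) pair_pre_digraph" where
  "lex_map G1 G2 G1' =
     \<lparr> pverts = pverts (lex_product G1 G2),
       parcs = (\<Union>(v, v') \<in> parcs G1'. supervertex G2 v \<times> supervertex G2 v') \<rparr>"

text \<open>
  \<open>F v\<close> is the set of edges added inside the supervertex of \<open>v\<close>. That these edges join vertices of
  this supervertex is part of the well-formedness required by \<^const>\<open>comparability_graph\<close>.
\<close>

definition special_subgraph ::
    "'a pair_pre_digraph \<Rightarrow> 'b pair_pre_digraph \<Rightarrow> ('a \<times> 'b) pair_pre_digraph \<Rightarrow> bool" where
  "special_subgraph G1 G2 Hs \<longleftrightarrow>
     (\<exists>G1' F. subgraph (with_proj G1') (with_proj G1) \<and> word_representable G1' \<and>
       (\<forall>v \<in> pverts G1. F v \<subseteq> parcs (lex_product G1 G2) \<and>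
          comparability_graph \<lparr> pverts = supervertex G2 v, parcs = F v \<rparr>) \<and>
       Hs = \<lparr> pverts = pverts (lex_map G1 G2 G1'),
              parcs = parcs (lex_map G1 G2 G1') \<union> (\<Union>v \<in> pverts G1. F v) \<rparr>)"

definition underlying_lex_map ::
    "'a pair_pre_digraph \<Rightarrow> 'b pair_pre_digraph \<Rightarrow> ('a \<times> 'b) pair_pre_digraph \<Rightarrow>
      ('a \<times> 'b) pair_pre_digraph" where
  "underlying_lex_map G1 G2 Hs =
     \<lparr> pverts = pverts Hs,
       parcs = parcs Hs - (\<Union>v \<in> pverts G1. supervertex G2 v \<times> supervertex G2 v) \<rparr>"

end

theory Submission
  imports Defs
begin

text \<open>
  A transitive orientation of \<open>G1'\<close> can be blown up: orient the edges between two supervertices like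
  the edge of \<open>G1'\<close> below them, and the edges inside each supervertex by a transitive orientation of
  their own. Conversely, restricting a transitive orientation of the blow-up to one copy
  \<open>V(G1) \<times> {b}\<close> orients \<open>G1'\<close> transitively. So whether the result is a comparability graph does not
  depend on the comparability graphs placed inside the supervertices, and placing no edges there
  gives the underlying lexicographic map.
\<close>

lemma pair_graph_iff:
  "pair_graph G \<longleftrightarrow>
     finite (pverts G) \<and> parcs G \<subseteq> pverts G \<times> pverts G \<and> irrefl (parcs G) \<and> sym (parcs G)"
proof
  assume "pair_graph G"
  then interpret pair_graph G .
  show "finite (pverts G) \<and> parcs G \<subseteq> pverts G \<times> pverts G \<and> irrefl (parcs G) \<and> sym (parcs G)"
    using in_arcsD1 in_arcsD2 no_loops arcs_symmetric
    by (fastforce simp: irrefl_def intro: symI)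
next
  assume *: "finite (pverts G) \<and> parcs G \<subseteq> pverts G \<times> pverts G \<and> irrefl (parcs G) \<and> sym (parcs G)"
  then have "finite (parcs G)"
    by (meson finite_SigmaI finite_subset)
  with * show "pair_graph G"
    by unfold_locales (auto simp: irrefl_def symmetric_def)
qed

text \<open>Taking \<open>F\<close> as a parameter puts \<open>Hs\<close> and its underlying
  lexicographic map into one family: the latter is the case where every \<open>F v\<close> is
  empty.\<close>

definition blow_up ::
    "'a pair_pre_digraph \<Rightarrow> 'b pair_pre_digraph \<Rightarrow> 'a pair_pre_digraph \<Rightarrow>
      ('a \<Rightarrow> ('a \<times> 'b) rel) \<Rightarrow> ('a \<times> 'b) pair_pre_digraph" where
  "blow_up G1 G2 G1' F =
     \<lparr> pverts = pverts (lex_map G1 G2 G1'),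
       parcs = parcs (lex_map G1 G2 G1') \<union> (\<Union>v \<in> pverts G1. F v) \<rparr>"

lemma pverts_blow_up: "pverts (blow_up G1 G2 G1' F) = pverts G1 \<times> pverts G2"
  by (simp add: blow_up_def lex_map_def lex_product_def)

lemma parcs_blow_up:
  "((u, x), (v, y)) \<in> parcs (blow_up G1 G2 G1' F) \<longleftrightarrow>
     (u, v) \<in> parcs G1' \<and> x \<in> pverts G2 \<and> y \<in> pverts G2 \<or>
     (\<exists>w \<in> pverts G1. ((u, x), (v, y)) \<in> F w)"
  by (auto simp: blow_up_def lex_map_def supervertex_def)

locale comparability_blow_up =
  fixes G1 G1' :: "'a pair_pre_digraph" and G2 :: "'b pair_pre_digraph"
    and F :: "'a \<Rightarrow> ('a \<times> 'b) rel"
  assumes G1: "pair_graph G1" and G2: "pair_graph G2" and G1': "pair_graph G1'"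
    and verts_sub: "pverts G1' \<subseteq> pverts G1"
    and F: "\<And>v. v \<in> pverts G1 \<Longrightarrow>
      comparability_graph \<lparr> pverts = supervertex G2 v, parcs = F v \<rparr>"
begin

abbreviation B where "B \<equiv> blow_up G1 G2 G1' F"

lemma F_props:
  assumes "v \<in> pverts G1"
  shows "F v \<subseteq> supervertex G2 v \<times> supervertex G2 v" "irrefl (F v)" "sym (F v)"
  using F[OF assms] by (auto simp: comparability_graph_def pair_graph_iff)

lemma F_memD:
  assumes "((u, x), (v, y)) \<in> F w" "w \<in> pverts G1"
  shows "u = w" "v = w" "x \<in> pverts G2" "y \<in> pverts G2" "x \<noteq> y"
  using F_props[OF assms(2)] assms(1) by (auto simp: supervertex_def irrefl_def)

lemma pair_graph_blow_up: "pair_graph B"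
  unfolding pair_graph_iff
proof (intro conjI)
  show "finite (pverts B)"
    using G1 G2 by (simp add: pverts_blow_up pair_graph_iff)
  show "parcs B \<subseteq> pverts B \<times> pverts B"
  proof clarify
    fix u x v y assume "((u, x), (v, y)) \<in> parcs B"
    then show "(u, x) \<in> pverts B \<and> (v, y) \<in> pverts B"
      using G1' verts_sub F_memD[of u x v y]
      unfolding parcs_blow_up pverts_blow_up pair_graph_iff by blast
  qed
  show "irrefl (parcs B)"
  proof (rule irreflI)
    fix p show "(p, p) \<notin> parcs B"
      using G1' by (cases p) (auto simp: parcs_blow_up pair_graph_iff irrefl_def dest: F_memD(5))
  qed
  show "sym (parcs B)"
  proof (rule symI)
    fix p q assume "(p, q) \<in> parcs B"
    then show "(q, p) \<in> parcs B"
      using G1'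
      by (cases p; cases q) (auto simp: parcs_blow_up pair_graph_iff dest: symD symD[OF F_props(3)])
  qed
qed

text \<open>The copy at height \<open>b\<close> meets each supervertex in at most one vertex, and
  \<open>F w\<close> is irreflexive, so no added arc survives there: \<open>B\<close> induces
  \<open>G1'\<close> on the copy, and transitivity passes to induced subgraphs.\<close>

lemma orientation_restrict_copy:
  assumes R: "orientation B R" "trans R" and b: "b \<in> pverts G2"
  defines "S \<equiv> {(u, v). ((u, b), (v, b)) \<in> R}"
  shows "orientation G1' S" "trans S"
proof -
  have "((u, b), (v, b)) \<in> parcs B \<longleftrightarrow> (u, v) \<in> parcs G1'" for u v
    using b F_memD(5)[of u b v b] by (auto simp: parcs_blow_up)
  with R(1) show "orientation G1' S"
    unfolding orientation_def S_def by (auto simp: set_eq_iff)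
  show "trans S"
    using R(2) unfolding S_def by (auto intro!: transI dest: transD)
qed

lemma comparability_blow_upI:
  assumes S: "orientation G1' S" "trans S"
  shows "comparability_graph B"
proof -
  have "\<forall>v \<in> pverts G1. \<exists>T. T \<union> T\<inverse> = F v \<and> T \<inter> T\<inverse> = {} \<and> trans T"
    using F by (simp add: comparability_graph_def orientation_def)
  then obtain T where T: "\<And>v. v \<in> pverts G1 \<Longrightarrow> T v \<union> (T v)\<inverse> = F v"
      "\<And>v. v \<in> pverts G1 \<Longrightarrow> T v \<inter> (T v)\<inverse> = {}" "\<And>v. v \<in> pverts G1 \<Longrightarrow> trans (T v)"
    by metis
  define R where "R = {((u, x), (v, y)) | u x v y.
    (u, v) \<in> S \<and> x \<in> pverts G2 \<and> y \<in> pverts G2 \<or> u = v \<and> u \<in> pverts G1 \<and> ((u, x), (u, y)) \<in> T u}"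
  have R_iff: "((u, x), (v, y)) \<in> R \<longleftrightarrow>
    (u, v) \<in> S \<and> x \<in> pverts G2 \<and> y \<in> pverts G2 \<or> u = v \<and> u \<in> pverts G1 \<and> ((u, x), (u, y)) \<in> T u"
    for u x v y by (simp add: R_def)
  have S_iff: "(u, v) \<in> parcs G1' \<longleftrightarrow> (u, v) \<in> S \<or> (v, u) \<in> S"
    and S_asym: "(u, v) \<in> S \<Longrightarrow> (v, u) \<notin> S" for u v
    using S(1) by (auto simp: orientation_def)
  \<comment> \<open>Arcs of \<open>F w\<close> stay in the supervertex of \<open>w\<close>, so the
    only possible witness is \<open>w = u\<close>.\<close>
  have F_iff: "(\<exists>w \<in> pverts G1. ((u, x), (v, y)) \<in> F w) \<longleftrightarrow>
    u = v \<and> u \<in> pverts G1 \<and> (((u, x), (u, y)) \<in> T u \<or> ((u, y), (u, x)) \<in> T u)" for u x v y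
    using F_memD(1,2)[of u x v y] T(1) by blast
  have T_memD: "x \<in> pverts G2" "y \<in> pverts G2"
    if "((u, x), (u, y)) \<in> T u" "u \<in> pverts G1" for u x y
    using F_memD(3,4)[of u x u y u] T(1) that by blast+
  have "(p, q) \<in> R \<union> R\<inverse> \<longleftrightarrow> (p, q) \<in> parcs B" for p q
    by (cases p; cases q) (auto simp: R_iff parcs_blow_up F_iff S_iff)
  \<comment> \<open>In the mixed case, an arc from \<open>S\<close> reversed by one from
    \<open>T u\<close>, both ends share the first coordinate; then \<open>(u, u)\<close> is in
    \<open>S\<close>, against asymmetry.\<close>
  moreover have "(p, q) \<notin> R \<inter> R\<inverse>" for p q
    using T(2) S_asym by (cases p; cases q) (auto simp: R_iff; blast)
  ultimately have "orientation B R"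
    unfolding orientation_def by (auto simp: set_eq_iff)
  \<comment> \<open>A step of \<open>S\<close> before or after a step inside a supervertex joins the
    same two supervertices as the \<open>S\<close> step alone. \<open>T_memD\<close> supplies the
    membership in \<open>pverts G2\<close> that \<open>R\<close> asks of the new endpoint.\<close>
  moreover have "trans R"
  proof (rule transI)
    fix p q r assume "(p, q) \<in> R" "(q, r) \<in> R"
    then show "(p, r) \<in> R"
      using S(2) T(3) T_memD by (cases p; cases q; cases r) (auto simp: R_iff dest: transD)
  qed
  ultimately show ?thesis
    using pair_graph_blow_up by (auto simp: comparability_graph_def)
qed

text \<open>The right-hand side does not mention \<open>F\<close>, which is what lets two blow-ups
  be compared. The empty case is separate because there is no \<open>b\<close> to choose a copy
  with; \<open>B\<close> then has no arcs at all.\<close>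

lemma comparability_blow_up_iff:
  "comparability_graph B \<longleftrightarrow> pverts G2 = {} \<or> comparability_graph G1'"
proof (cases "pverts G2 = {}")
  case True
  then have "parcs B = {}"
    using pair_graph_blow_up by (auto simp: pair_graph_iff pverts_blow_up)
  then have "orientation B {}"
    by (simp add: orientation_def)
  then show ?thesis
    using True pair_graph_blow_up by (auto simp: comparability_graph_def)
next
  case False
  then show ?thesis
    using orientation_restrict_copy comparability_blow_upI G1'
    by (fastforce simp: comparability_graph_def)
qed

end

lemma comparability_graph_no_arcs:
  "finite V \<Longrightarrow> comparability_graph \<lparr> pverts = V, parcs = {} \<rparr>"
  by (auto simp: comparability_graph_def orientation_def pair_graph_iff irrefl_def
      intro: exI[of _ "{}"])

text \<open>As \<open>G1'\<close> has no loops, the arcs it contributes always join different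
  supervertices, so the deletion removes exactly the arcs of the \<open>F v\<close>.\<close>

lemma (in comparability_blow_up) underlying_lex_map_blow_up:
  "underlying_lex_map G1 G2 B = blow_up G1 G2 G1' (\<lambda>_. {})"
proof -
  have "(p, q) \<in> parcs B - (\<Union>v \<in> pverts G1. supervertex G2 v \<times> supervertex G2 v) \<longleftrightarrow>
      (p, q) \<in> parcs (blow_up G1 G2 G1' (\<lambda>_. {}))" for p q
    using G1' F_memD
    by (cases p; cases q)
      (fastforce simp: parcs_blow_up supervertex_def pair_graph_iff irrefl_def)
  then have "parcs B - (\<Union>v \<in> pverts G1. supervertex G2 v \<times> supervertex G2 v) =
      parcs (blow_up G1 G2 G1' (\<lambda>_. {}))"
    by (simp add: set_eq_iff split_paired_all)
  then show ?thesis
    unfolding underlying_lex_map_def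
    by (intro pair_pre_digraph.equality) (simp_all add: pverts_blow_up)
qed

theorem theorem7:
  fixes G1 :: "'a pair_pre_digraph" and G2 :: "'b pair_pre_digraph"
    and Hs :: "('a \<times> 'b) pair_pre_digraph"
  assumes "pair_graph G1" and "pair_graph G2"
    and "special_subgraph G1 G2 Hs"
  shows "comparability_graph Hs \<longleftrightarrow> comparability_graph (underlying_lex_map G1 G2 Hs)"
proof -
  obtain G1' F where "subgraph (with_proj G1') (with_proj G1)"
    and "word_representable G1'"
    and F: "\<And>v. v \<in> pverts G1 \<Longrightarrow>
      comparability_graph \<lparr> pverts = supervertex G2 v, parcs = F v \<rparr>"
    and Hs: "Hs = blow_up G1 G2 G1' F"
    using assms(3) unfolding special_subgraph_def blow_up_def by blast
  then have G1': "pair_graph G1'" "pverts G1' \<subseteq> pverts G1"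
    by (auto simp: word_representable_def subgraph_def)
  interpret special: comparability_blow_up G1 G1' G2 F
    using assms(1,2) G1' F by (simp add: comparability_blow_up_def)
  have "finite (supervertex G2 v)" for v :: 'a
    using assms(2) by (auto simp: supervertex_def pair_graph_iff)
  \<comment> \<open>The empty family is admissible: the empty relation transitively orients an
    arcless graph.\<close>
  then interpret underlying: comparability_blow_up G1 G1' G2 "\<lambda>_. {}"
    using assms(1,2) G1' by (simp add: comparability_blow_up_def comparability_graph_no_arcs)
  \<comment> \<open>Both sides reduce to the same condition on \<open>G2\<close> and
    \<open>G1'\<close>.\<close>
  show ?thesis
    unfolding Hs special.underlying_lex_map_blow_up
      special.comparability_blow_up_iff underlying.comparability_blow_up_iff ..
qed

end
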